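(* Let $\mathcal{A}=(A,\to_\mathcal{A})$ be an abstract reduction system, let $P\subseteq A$ and $Q,E\subseteq\mathrm{NF}_\mathcal{A}$, and suppose $P\Rightarrow Q$ is a safety APR predicate for $E$ w.r.t. $\mathcal{A}$. Then $P\Rightarrow Q$ is partially valid w.r.t. $\mathcal{A}$ if and only if there is no finite execution path of $\mathcal{A}$ that starts with an element of $P$ and includes an element of $E$.
   Context: An abstract reduction system is a pair $\mathcal{A}=(A,\to_\mathcal{A})$ of a set $A$ and a binary relation on $A$; $\to_\mathcal{A}^*$ is its reflexive-transitive closure; $\mathrm{NF}_\mathcal{A}$ is the set of normal forms; $\Delta_\mathcal{A}(P)=\{t\mid\exists s\in P.\ s\to_\mathcal{A}t\}$; $P$ is $\mathcal{A}$-runnable if $P\neq\emptyset$ and $P\cap\mathrm{NF}_\mathcal{A}=\emptyset$. An execution path is a maximal reduction sequence $s_0\to_\mathcal{A}s_1\to_\mathcal{A}\cdots$: either finite ending in an element of $\mathrm{NF}_\mathcal{A}$, or infinite. An APR predicate is a pair $P\Rightarrow Q$ with $P,Q\subseteq A$. $P\Rightarrow Q$ is partially valid w.r.t. $\mathcal{A}$ if it lies in the greatest fixed point of the functional (mapping a set $X$ of predicates to the conclusions of rule instances with all premises in $X$ and side conditions true) of the rules (Subsumption) no premises, conclude $P\Rightarrow Q$ if $P\subseteq Q$; (Step) from $\Delta_\mathcal{A}(P\setminus Q)\Rightarrow Q$ conclude $P\Rightarrow Q$ if $P\setminus Q$ is $\mathcal{A}$-runnable. For a set $E\subseteq\mathrm{NF}_\mathcal{A}$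 (of error states), $P\Rightarrow Q$ is a safety APR predicate for $E$ w.r.t. $\mathcal{A}$ if $Q\cap E=\emptyset$, $\{t\in\mathrm{NF}_\mathcal{A}\setminus E\mid\exists s\in P.\ s\to_\mathcal{A}^*t\}\subseteq Q$, and $Q\subseteq\mathrm{NF}_\mathcal{A}$. *)

theory Defs
  imports Main
begin

text \<open>
  An abstract reduction system is a carrier set \<open>A\<close> together with a relation
  \<open>R \<subseteq> A \<times> A\<close>; the inclusion is an explicit hypothesis wherever it is needed.
\<close>

definition NF :: "'a set \<Rightarrow> 'a rel \<Rightarrow> 'a set" where
  "NF A R = {s \<in> A. \<nexists>t. (s, t) \<in> R}"

definition derivative :: "'a rel \<Rightarrow> 'a set \<Rightarrow> 'a set" where
  "derivative R P = {t. \<exists>s \<in> P. (s, t) \<in> R}"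

definition runnable :: "'a set \<Rightarrow> 'a rel \<Rightarrow> 'a set \<Rightarrow> bool" where
  "runnable A R P \<longleftrightarrow> P \<noteq> {} \<and> P \<inter> NF A R = {}"

text \<open>The pair \<open>(P, Q)\<close> stands for the all-path reachability predicate \<open>P \<Rightarrow> Q\<close>.\<close>

type_synonym 'a apr = "'a set \<times> 'a set"

text \<open>
  \<open>apr_rule A R H c\<close>: there is a rule instance with set of premises \<open>H\<close>, conclusion \<open>c\<close>
  and true side conditions. This predicate is not recursive; the coinductive reading
  of the rules comes from the greatest fixed point in \<open>partially_valid\<close>.
\<close>

inductive apr_rule :: "'a set \<Rightarrow> 'a rel \<Rightarrow> 'a apr set \<Rightarrow> 'a apr \<Rightarrow> bool"
  for A :: "'a set" and R :: "'a rel" where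
  Subsumption:
    "\<lbrakk>P \<subseteq> A; Q \<subseteq> A; P \<subseteq> Q\<rbrakk> \<Longrightarrow> apr_rule A R {} (P, Q)"
| Step:
    "\<lbrakk>P \<subseteq> A; Q \<subseteq> A; runnable A R (P - Q)\<rbrakk>
      \<Longrightarrow> apr_rule A R {(derivative R (P - Q), Q)} (P, Q)"

definition apr_functional :: "'a set \<Rightarrow> 'a rel \<Rightarrow> 'a apr set \<Rightarrow> 'a apr set" where
  "apr_functional A R X = {c. \<exists>H. H \<subseteq> X \<and> apr_rule A R H c}"

lemma mono_apr_functional: "mono (apr_functional A R)"
  unfolding mono_def apr_functional_def by blast

definition partially_valid :: "'a set \<Rightarrow> 'a rel \<Rightarrow> 'a set \<Rightarrow> 'a set \<Rightarrow> bool" where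
  "partially_valid A R P Q \<longleftrightarrow> (P, Q) \<in> gfp (apr_functional A R)"

definition safety_apr :: "'a set \<Rightarrow> 'a rel \<Rightarrow> 'a set \<Rightarrow> 'a set \<Rightarrow> 'a set \<Rightarrow> bool" where
  "safety_apr A R E P Q \<longleftrightarrow>
     Q \<inter> E = {} \<and>
     {t \<in> NF A R - E. \<exists>s \<in> P. (s, t) \<in> R\<^sup>*} \<subseteq> Q \<and>
     Q \<subseteq> NF A R"

text \<open>
  The list of states of a finite maximal reduction sequence; a one-element list is a
  sequence of length zero starting in a normal form.
\<close>

definition finite_execution_path :: "'a set \<Rightarrow> 'a rel \<Rightarrow> 'a list \<Rightarrow> bool" where
  "finite_execution_path A R ss \<longleftrightarrow>
     ss \<noteq> [] \<and> set ss \<subseteq> A \<and> successively (\<lambda>s t. (s, t) \<in> R) ss \<and> last ss \<in> NF A R"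

end

theory Submission
  imports Defs
begin

text \<open>
  When \<open>Q\<close> consists of normal forms, partial validity of \<open>P \<Rightarrow> Q\<close> means that every normal form
  reachable from \<open>P\<close> lies in \<open>Q\<close>: the reachability condition is preserved by the derivative,
  hence is a post-fixed point of the rules, and conversely every reduction to a normal form can be
  followed through finitely many (Step) instances. The safety condition leaves exactly the
  normal forms in \<open>E\<close> to be excluded.
\<close>

lemma rtrancl_imp_successively:
  assumes "(s, t) \<in> R\<^sup>*"
  shows "\<exists>ss. ss \<noteq> [] \<and> hd ss = s \<and> last ss = t \<and> successively (\<lambda>x y. (x, y) \<in> R) ss"
  using assms
proof (induction rule: converse_rtrancl_induct)
  case base
  show ?case by (rule exI[of _ "[t]"]) simp
next
  case (step s u)
  then obtain ss where "ss \<noteq> []" "hd ss = u" "last ss = t" "successively (\<lambda>x y. (x, y) \<in> R) ss"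
    by blast
  then show ?case
    using step.hyps(1) by (intro exI[of _ "s # ss"]) (simp add: successively_Cons)
qed

lemma successively_imp_rtrancl:
  assumes "successively (\<lambda>x y. (x, y) \<in> R) ss" "t \<in> set ss"
  shows "(hd ss, t) \<in> R\<^sup>*"
  using assms
proof (induction ss)
  case (Cons s ss)
  then show ?case
    by (cases "t = s") (auto simp: successively_Cons intro: converse_rtrancl_into_rtrancl)
qed simp

lemma successively_set_subset:
  assumes "R \<subseteq> A \<times> A" "hd ss \<in> A" "successively (\<lambda>x y. (x, y) \<in> R) ss"
  shows "set ss \<subseteq> A"
proof
  fix t assume "t \<in> set ss"
  with assms(3) have "(hd ss, t) \<in> R\<^sup>*" by (rule successively_imp_rtrancl)
  then show "t \<in> A" using assms(1,2) by cases auto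
qed

text \<open>Error states are normal forms, so a reduction from \<open>P\<close> that reaches one
  cannot be extended and is itself a finite execution path. This replaces paths by plain
  reachability.\<close>

lemma finite_execution_path_iff_reachable:
  assumes "R \<subseteq> A \<times> A" "P \<subseteq> A" "E \<subseteq> NF A R"
  shows "(\<exists>ss. finite_execution_path A R ss \<and> hd ss \<in> P \<and> set ss \<inter> E \<noteq> {}) \<longleftrightarrow>
    (\<exists>s \<in> P. \<exists>t \<in> E. (s, t) \<in> R\<^sup>*)"
proof
  assume "\<exists>ss. finite_execution_path A R ss \<and> hd ss \<in> P \<and> set ss \<inter> E \<noteq> {}"
  then show "\<exists>s \<in> P. \<exists>t \<in> E. (s, t) \<in> R\<^sup>*"
    unfolding finite_execution_path_def by (blast dest: successively_imp_rtrancl)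
next
  assume "\<exists>s \<in> P. \<exists>t \<in> E. (s, t) \<in> R\<^sup>*"
  then obtain s t where st: "s \<in> P" "t \<in> E" "(s, t) \<in> R\<^sup>*" by blast
  then obtain ss where ss: "ss \<noteq> []" "hd ss = s" "last ss = t"
      "successively (\<lambda>x y. (x, y) \<in> R) ss"
    using rtrancl_imp_successively by metis
  have "set ss \<subseteq> A"
    using successively_set_subset[OF assms(1) _ ss(4)] ss(2) st(1) assms(2) by blast
  then have "finite_execution_path A R ss"
    unfolding finite_execution_path_def using ss st(2) assms(3) by blast
  moreover have "t \<in> set ss" using ss(1,3) last_in_set by blast
  ultimately show "\<exists>ss. finite_execution_path A R ss \<and> hd ss \<in> P \<and> set ss \<inter> E \<noteq> {}"
    using ss(2) st(1,2) by blast
qed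

text \<open>One unfolding of the greatest fixed point, followed by inversion of the rule applied
  last.\<close>

lemma partially_valid_cases:
  assumes "partially_valid A R P Q"
  obtains (Subsumption) "P \<subseteq> Q"
  | (Step) "runnable A R (P - Q)" "partially_valid A R (derivative R (P - Q)) Q"
proof -
  have "(P, Q) \<in> apr_functional A R (gfp (apr_functional A R))"
    using assms gfp_unfold[OF mono_apr_functional[of A R]] unfolding partially_valid_def by blast
  then obtain H where "H \<subseteq> gfp (apr_functional A R)" "apr_rule A R H (P, Q)"
    unfolding apr_functional_def by blast
  from this(2,1) that show thesis
    by cases (auto simp: partially_valid_def)
qed

text \<open>A greatest fixed point offers no induction, so the induction runs along the finite
  reduction, from its front. \<open>P\<close> is generalised because each (Step) replaces it by a
  derivative.\<close>

lemma partially_valid_reaches: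
  assumes "(s, t) \<in> R\<^sup>*" "t \<in> NF A R" "Q \<subseteq> NF A R" "partially_valid A R P Q" "s \<in> P"
  shows "t \<in> Q"
  using assms(1,4,5)
proof (induction arbitrary: P rule: converse_rtrancl_induct)
  case base
  \<comment> \<open>Here \<open>t\<close> is a normal form in \<open>P\<close>. If it were outside
    \<open>Q\<close>, it would make \<open>P - Q\<close> non-runnable, and (Subsumption) would fail
    as well.\<close>
  from base.prems(1) show ?case
    using base.prems(2) assms(2) by (cases rule: partially_valid_cases) (auto simp: runnable_def)
next
  case (step s u)
  \<comment> \<open>A state with a successor is no normal form, so removing \<open>Q\<close> from
    \<open>P\<close> does not discard \<open>s\<close>.\<close>
  have "s \<notin> Q" using step.hyps(1) assms(3) unfolding NF_def by blast
  from step.prems(1) show ?case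
  proof (cases rule: partially_valid_cases)
    case Subsumption
    then show ?thesis using step.prems(2) \<open>s \<notin> Q\<close> by blast
  next
    case Step
    have "u \<in> derivative R (P - Q)"
      using step.hyps(1) step.prems(2) \<open>s \<notin> Q\<close> unfolding derivative_def by blast
    then show ?thesis using step.IH Step(2) by blast
  qed
qed

text \<open>Coinduction: the reachability condition with \<open>Q\<close> fixed defines a set of
  predicates that is contained in its image under the rules.\<close>

lemma partially_validI:
  assumes "R \<subseteq> A \<times> A" "P \<subseteq> A" "Q \<subseteq> A"
    and "\<And>s t. s \<in> P \<Longrightarrow> (s, t) \<in> R\<^sup>* \<Longrightarrow> t \<in> NF A R \<Longrightarrow> t \<in> Q"
  shows "partially_valid A R P Q"
proof -
  define X where "X = {(P', Q) | P'. P' \<subseteq> A \<and> (\<forall>s \<in> P'. \<forall>t \<in> NF A R. (s, t) \<in> R\<^sup>* \<longrightarrow> t \<in> Q)}"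
  have "X \<subseteq> apr_functional A R X"
  proof
    fix c assume "c \<in> X"
    then obtain P' where c: "c = (P', Q)" and "P' \<subseteq> A"
      and reach: "\<And>s t. s \<in> P' \<Longrightarrow> t \<in> NF A R \<Longrightarrow> (s, t) \<in> R\<^sup>* \<Longrightarrow> t \<in> Q"
      unfolding X_def by blast
    show "c \<in> apr_functional A R X"
    proof (cases "P' \<subseteq> Q")
      case True
      then show ?thesis
        unfolding c apr_functional_def
        using apr_rule.Subsumption[OF \<open>P' \<subseteq> A\<close> assms(3)] by blast
    next
      case False
      \<comment> \<open>A normal form in \<open>P'\<close> reaches itself in zero steps and hence
        lies in \<open>Q\<close>; so none remains in \<open>P' - Q\<close>.\<close>
      then have "runnable A R (P' - Q)"
        using reach unfolding runnable_def by blast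
      \<comment> \<open>A reduction from a successor, prefixed with one step, is a reduction from
        \<open>P'\<close>.\<close>
      moreover have "(derivative R (P' - Q), Q) \<in> X"
        using assms(1) reach unfolding X_def derivative_def
        by (auto intro: converse_rtrancl_into_rtrancl)
      ultimately show ?thesis
        unfolding c apr_functional_def
        using apr_rule.Step[OF \<open>P' \<subseteq> A\<close> assms(3)] by blast
    qed
  qed
  moreover have "(P, Q) \<in> X"
    using assms(2,4) unfolding X_def by blast
  ultimately show ?thesis
    unfolding partially_valid_def using gfp_upperbound[of X "apr_functional A R"] by blast
qed

theorem theorem23:
  fixes A :: "'a set" and R :: "'a rel" and P Q E :: "'a set"
  assumes "R \<subseteq> A \<times> A"
    and "P \<subseteq> A"
    and "Q \<subseteq> NF A R"
    and "E \<subseteq> NF A R"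
    and "safety_apr A R E P Q"
  shows "partially_valid A R P Q \<longleftrightarrow>
    \<not> (\<exists>ss. finite_execution_path A R ss \<and> hd ss \<in> P \<and> set ss \<inter> E \<noteq> {})"
proof -
  have "Q \<inter> E = {}"
    and safe: "\<And>s t. s \<in> P \<Longrightarrow> (s, t) \<in> R\<^sup>* \<Longrightarrow> t \<in> NF A R \<Longrightarrow> t \<notin> E \<Longrightarrow> t \<in> Q"
    using assms(5) unfolding safety_apr_def by blast+
  have "Q \<subseteq> A" using assms(3) unfolding NF_def by blast
  have "partially_valid A R P Q \<longleftrightarrow> \<not> (\<exists>s \<in> P. \<exists>t \<in> E. (s, t) \<in> R\<^sup>*)"
  proof
    assume pv: "partially_valid A R P Q"
    \<comment> \<open>A reachable error state would be a reachable normal form, hence in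
      \<open>Q\<close>, which is disjoint from \<open>E\<close>.\<close>
    have "t \<in> Q" if "s \<in> P" "t \<in> E" "(s, t) \<in> R\<^sup>*" for s t
      using partially_valid_reaches[OF that(3) _ assms(3) pv that(1)] that(2) assms(4) by blast
    then show "\<not> (\<exists>s \<in> P. \<exists>t \<in> E. (s, t) \<in> R\<^sup>*)"
      using \<open>Q \<inter> E = {}\<close> by blast
  next
    assume unreachable: "\<not> (\<exists>s \<in> P. \<exists>t \<in> E. (s, t) \<in> R\<^sup>*)"
    show "partially_valid A R P Q"
    proof (rule partially_validI[OF assms(1,2) \<open>Q \<subseteq> A\<close>])
      fix s t assume "s \<in> P" "(s, t) \<in> R\<^sup>*" "t \<in> NF A R"
      \<comment> \<open>With \<open>E\<close> unreachable, the safety condition places every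
        reachable normal form in \<open>Q\<close>.\<close>
      moreover from this have "t \<notin> E" using unreachable by blast
      ultimately show "t \<in> Q" by (rule safe)
    qed
  qed
  then show ?thesis
    using finite_execution_path_iff_reachable[OF assms(1,2,4)] by simp
qed

end
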